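(* For any $2n\times2n$ indefinite unitary matrix $U\in\mathrm{U}(n,n)$, there exist two $n\times n$ unitary matrices $U_1,U_2$, an $n\times n$ quaternionic orthogonal matrix $V\in\mathbb{H}^{n\times n}$ such that $V^{D_i}V=I_n$, and $n$ unique (up to order and signs) real numbers $\theta_1,\dots,\theta_n$ such that $$U=\begin{bmatrix} U_1 & 0 \\ 0 & U_2 \end{bmatrix}\begin{bmatrix} Ch & Sh \\ Sh & Ch \end{bmatrix}[V]_{\mathbb{C}}.$$
   Context: $\mathrm{U}(n,n)=\{G\in\mathbb{C}^{2n\times2n}:G^HI_{n,n}G=I_{n,n}\}$ with $I_{n,n}=\operatorname{diag}(I_n,-I_n)$ and $^H$ the conjugate transpose. $\mathbb{H}$ denotes the real quaternions with imaginary units $i,j,k$; for $M\in\mathbb{H}^{n\times n}$, $(M^D)_{ab}=\overline{M_{ba}}$ and $M^{D_i}=-iM^Di$. The complexify map sends $Y=Y_0+iY_1+jY_2+kY_3$ (with $Y_0,\dots,Y_3$ real matrices) to $$[Y]_{\mathbb{C}}=\begin{bmatrix} Y_0+iY_1 & Y_2+iY_3 \\ -Y_2+iY_3 & Y_0-iY_1 \end{bmatrix}.$$ $Ch=\operatorname{diag}(\cosh\theta_1,\dots,\cosh\theta_n)$ and $Sh=\operatorname{diag}(\sinh\theta_1,\dots,\sinh\theta_n)$. *)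

theory Defs
  imports Complex_Main "Jordan_Normal_Form.Schur_Decomposition"
begin

datatype quat = Quat (qRe: real) (qIm1: real) (qIm2: real) (qIm3: real)

instantiation quat :: ring_1
begin

definition zero_quat :: quat where "0 = Quat 0 0 0 0"

definition one_quat :: quat where "1 = Quat 1 0 0 0"

definition plus_quat :: "quat \<Rightarrow> quat \<Rightarrow> quat" where
  "x + y = Quat (qRe x + qRe y) (qIm1 x + qIm1 y) (qIm2 x + qIm2 y) (qIm3 x + qIm3 y)"

definition uminus_quat :: "quat \<Rightarrow> quat" where
  "- x = Quat (- qRe x) (- qIm1 x) (- qIm2 x) (- qIm3 x)"

definition minus_quat :: "quat \<Rightarrow> quat \<Rightarrow> quat" where
  "x - y = Quat (qRe x - qRe y) (qIm1 x - qIm1 y) (qIm2 x - qIm2 y) (qIm3 x - qIm3 y)"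

definition times_quat :: "quat \<Rightarrow> quat \<Rightarrow> quat" where
  "x * y = Quat
     (qRe x * qRe y - qIm1 x * qIm1 y - qIm2 x * qIm2 y - qIm3 x * qIm3 y)
     (qRe x * qIm1 y + qIm1 x * qRe y + qIm2 x * qIm3 y - qIm3 x * qIm2 y)
     (qRe x * qIm2 y - qIm1 x * qIm3 y + qIm2 x * qRe y + qIm3 x * qIm1 y)
     (qRe x * qIm3 y + qIm1 x * qIm2 y - qIm2 x * qIm1 y + qIm3 x * qRe y)"

instance
  by standard
    (simp_all add: zero_quat_def one_quat_def plus_quat_def uminus_quat_def minus_quat_def
      times_quat_def algebra_simps quat.expand)

end

definition quat_i :: quat where "quat_i = Quat 0 1 0 0"
definition quat_j :: quat where "quat_j = Quat 0 0 1 0"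
definition quat_k :: quat where "quat_k = Quat 0 0 0 1"

lemma quat_units:
  "quat_i * quat_i = - 1" "quat_j * quat_j = - 1" "quat_k * quat_k = - 1"
  "quat_i * quat_j = quat_k" "quat_j * quat_k = quat_i" "quat_k * quat_i = quat_j"
  "quat_j * quat_i = - quat_k" "quat_k * quat_j = - quat_i" "quat_i * quat_k = - quat_j"
  by (simp_all add: quat_i_def quat_j_def quat_k_def times_quat_def one_quat_def uminus_quat_def)

definition quat_cnj :: "quat \<Rightarrow> quat" where
  "quat_cnj q = Quat (qRe q) (- qIm1 q) (- qIm2 q) (- qIm3 q)"

definition quat_adjoint :: "quat mat \<Rightarrow> quat mat" where
  "quat_adjoint M = map_mat quat_cnj (transpose_mat M)"

(* M^{D_i} = - i M^D i; the quaternion i multiplies every entry from both sides. *)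
definition quat_adjoint_i :: "quat mat \<Rightarrow> quat mat" where
  "quat_adjoint_i M = map_mat (\<lambda>q. - quat_i * q * quat_i) (quat_adjoint M)"

definition quat_orthogonal :: "nat \<Rightarrow> quat mat set" where
  "quat_orthogonal n = {V \<in> carrier_mat n n. quat_adjoint_i V * V = 1\<^sub>m n}"

definition complexify :: "quat mat \<Rightarrow> complex mat" where
  "complexify Y = four_block_mat
     (map_mat (\<lambda>q. Complex (qRe q) (qIm1 q)) Y)
     (map_mat (\<lambda>q. Complex (qIm2 q) (qIm3 q)) Y)
     (map_mat (\<lambda>q. Complex (- qIm2 q) (qIm3 q)) Y)
     (map_mat (\<lambda>q. Complex (qRe q) (- qIm1 q)) Y)"

definition unitary_group :: "nat \<Rightarrow> complex mat set" where
  "unitary_group n = {G \<in> carrier_mat n n. mat_adjoint G * G = 1\<^sub>m n}"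

definition signature_mat :: "nat \<Rightarrow> complex mat" where
  "signature_mat n = four_block_mat (1\<^sub>m n) (0\<^sub>m n n) (0\<^sub>m n n) (- 1\<^sub>m n)"

definition indefinite_unitary_group :: "nat \<Rightarrow> complex mat set" where
  "indefinite_unitary_group n =
     {G \<in> carrier_mat (2 * n) (2 * n). mat_adjoint G * signature_mat n * G = signature_mat n}"

definition Ch :: "nat \<Rightarrow> (nat \<Rightarrow> real) \<Rightarrow> complex mat" where
  "Ch n \<theta> = mat_diag n (\<lambda>a. complex_of_real (cosh (\<theta> a)))"

definition Sh :: "nat \<Rightarrow> (nat \<Rightarrow> real) \<Rightarrow> complex mat" where
  "Sh n \<theta> = mat_diag n (\<lambda>a. complex_of_real (sinh (\<theta> a)))"

(* Only the values theta 0, ..., theta (n - 1) matter. *)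
definition factorization ::
  "nat \<Rightarrow> complex mat \<Rightarrow> complex mat \<Rightarrow> complex mat \<Rightarrow> quat mat \<Rightarrow> (nat \<Rightarrow> real) \<Rightarrow> bool" where
  "factorization n U U1 U2 V \<theta> \<longleftrightarrow>
     U1 \<in> unitary_group n \<and> U2 \<in> unitary_group n \<and> V \<in> quat_orthogonal n \<and>
     U = four_block_mat U1 (0\<^sub>m n n) (0\<^sub>m n n) U2
         * four_block_mat (Ch n \<theta>) (Sh n \<theta>) (Sh n \<theta>) (Ch n \<theta>)
         * complexify V"

definition equal_up_to_order_and_signs :: "nat \<Rightarrow> (nat \<Rightarrow> real) \<Rightarrow> (nat \<Rightarrow> real) \<Rightarrow> bool" where
  "equal_up_to_order_and_signs n \<theta> \<theta>' \<longleftrightarrow>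
     (\<exists>p. p permutes {..<n} \<and> (\<forall>a<n. \<theta>' a = \<theta> (p a) \<or> \<theta>' a = - \<theta> (p a)))"

end

(* Let S be the block matrix [[0, I], [I, 0]]. Inside U(n,n), the matrices [V]_C with V
   quaternionic orthogonal are exactly the C with C S C^T = S, so the coset of U modulo this subgroup is
   determined by the complex symmetric matrix Q = U S U^T. For U = diag(U1, U2) A [V]_C the upper
   left block of Q is U1 sinh(2 Theta) U1^T. This is a Takagi factorization, whence the squares
   sinh^2(2 theta_a) are the eigenvalues of X X^H and the theta_a are unique up to order and signs.
   Conversely, a Takagi factorization of the upper left block of Q gives U1 and Theta, and the
   relation Q^H I_{n,n} Q = - I_{n,n} forces the other blocks into the required form. *)

theory Submission
  imports Defs
begin

section \<open>Conjugate transposes\<close>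

text \<open>S anticommutes with I_{n,n}, since S I_{n,n} S = - I_{n,n}; this is the origin of the
  minus sign in the relation for Q. In terms of the upper left block X and the upper right block Y
  of Q, the relation contains conj(Y) Y^T = 1 + conj(X) X, a matrix form of cosh^2 = 1 + sinh^2.
  Hence the angles come from \<open>arsinh\<close>, and cosh(2 Theta) is invertible for every Theta,
  so U2 can be solved for from Y even where some theta_a vanish or coincide. A start from singular
  value decompositions of the blocks of U would leave U1 and U2 to be matched on the eigenspaces of
  repeated values. For a similar reason the Takagi factorization is obtained by deflation: a unitary
  matrix that diagonalizes X X^H need not bring X itself into diagonal form when eigenvalues
  coincide. The Takagi values are real numbers of arbitrary sign, which suffices because each
  theta_a is determined only up to sign.\<close>

abbreviation cnj_mat :: "complex mat \<Rightarrow> complex mat" where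
  "cnj_mat \<equiv> map_mat cnj"

lemma mat_adjoint_eq: "mat_adjoint A = cnj_mat A\<^sup>T"
  by (rule eq_matI) (auto simp: mat_adjoint_def mat_of_rows_def)

lemma cnj_mat_mult: "dim_col A = dim_row B \<Longrightarrow> cnj_mat (A * B) = cnj_mat A * cnj_mat B"
  by (rule eq_matI) (auto simp: scalar_prod_def cnj_sum)

lemma cnj_mat_cnj_mat [simp]: "cnj_mat (cnj_mat A) = A"
  by (rule eq_matI) auto

lemma cnj_mat_one [simp]: "cnj_mat (1\<^sub>m n) = 1\<^sub>m n"
  by (rule eq_matI) auto

lemma cnj_mat_diag_of_real [simp]:
  "cnj_mat (mat_diag n (\<lambda>a. complex_of_real (f a))) = mat_diag n (\<lambda>a. complex_of_real (f a))"
  by (rule eq_matI) (auto simp: mat_diag_def)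

lemma transpose_mat_diag [simp]: "(mat_diag n f)\<^sup>T = mat_diag n f"
  by (rule eq_matI) (auto simp: mat_diag_def)

lemma dim_mat_diag [simp]: "dim_row (mat_diag n f) = n" "dim_col (mat_diag n f) = n"
  by (simp_all add: mat_diag_def)

text \<open>Equations between dimensions replace carrier sets, so that the simplifier can discharge
  the premises without guessing sizes.\<close>

lemma mat_assoc:
  "dim_col A = dim_row B \<Longrightarrow> dim_col B = dim_row C \<Longrightarrow> (A * B) * C = A * (B * (C :: 'a :: semiring_0 mat))"
  by (rule assoc_mult_mat) auto

lemma mat_transpose_mult:
  "dim_col A = dim_row B \<Longrightarrow> (A * B)\<^sup>T = B\<^sup>T * (A :: 'a :: comm_semiring_0 mat)\<^sup>T"
  by (rule transpose_mult) auto

lemma mat_diag_diag_left: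
  "dim_row A = n \<Longrightarrow> mat_diag n f * (mat_diag n g * A) = mat_diag n (\<lambda>i. f i * g i) * (A :: 'a :: semiring_0 mat)"
  by (subst mat_assoc[symmetric]) auto

text \<open>Normal form for products: factors nested to the right, conjugation innermost,
  transposition next, and adjacent diagonal matrices merged.\<close>

lemmas mat_monoid = mat_assoc mat_transpose_mult cnj_mat_mult
  map_mat_transpose[symmetric] mat_diag_diag_left

text \<open>In right-nested products an inverse pair stands in front of a remaining factor, so
  cancellation is stated with the tail \<open>X\<close>.\<close>

lemma mat_inverse_cancel:
  assumes "A * B = (1\<^sub>m n :: 'a :: semiring_1 mat)" "dim_col A = dim_row B" "dim_row X = n" "dim_col B = n"
  shows "A * (B * X) = X"
proof -
  have "A * (B * X) = (A * B) * X" by (rule mat_assoc[symmetric]) (use assms in simp_all)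
  then show ?thesis using assms by simp
qed

lemma mat_inverse_commute:
  fixes A :: "'a :: field mat"
  assumes "A * B = 1\<^sub>m n" "A \<in> carrier_mat n n" "B \<in> carrier_mat n n"
  shows "B * A = 1\<^sub>m n"
  using mat_mult_left_right_inverse[OF assms(2,3,1)] .

lemma mem_unitary_group_iff:
  "W \<in> unitary_group n \<longleftrightarrow> W \<in> carrier_mat n n \<and> cnj_mat W\<^sup>T * W = 1\<^sub>m n"
  by (auto simp: unitary_group_def mat_adjoint_eq)

lemma unitary_groupD:
  assumes "W \<in> unitary_group n"
  shows "dim_row W = n" "dim_col W = n"
    "(cnj_mat W)\<^sup>T * W = 1\<^sub>m n" "W * (cnj_mat W)\<^sup>T = 1\<^sub>m n"
    "W\<^sup>T * cnj_mat W = 1\<^sub>m n" "cnj_mat W * W\<^sup>T = 1\<^sub>m n"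
proof -
  have W: "W \<in> carrier_mat n n" and 1: "cnj_mat W\<^sup>T * W = 1\<^sub>m n"
    using assms by (auto simp: mem_unitary_group_iff)
  show d: "dim_row W = n" "dim_col W = n" using W by auto
  show 1: "(cnj_mat W)\<^sup>T * W = 1\<^sub>m n" using 1 by (simp add: map_mat_transpose)
  then show 2: "W * (cnj_mat W)\<^sup>T = 1\<^sub>m n"
    by (rule mat_inverse_commute) (use W in auto)
  show "W\<^sup>T * cnj_mat W = 1\<^sub>m n"
    using arg_cong[OF 1, of cnj_mat] by (simp add: mat_monoid d)
  show "cnj_mat W * W\<^sup>T = 1\<^sub>m n"
    using arg_cong[OF 2, of cnj_mat] by (simp add: mat_monoid d)
qed

lemma unitary_cancel:
  assumes "W \<in> unitary_group n" "dim_row X = n"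
  shows "(cnj_mat W)\<^sup>T * (W * X) = X" "W * ((cnj_mat W)\<^sup>T * X) = X"
    "W\<^sup>T * (cnj_mat W * X) = X" "cnj_mat W * (W\<^sup>T * X) = X"
  by (rule mat_inverse_cancel[where n = n]; use unitary_groupD[OF assms(1)] assms(2) in simp)+

lemma unitary_group_mult:
  assumes "A \<in> unitary_group n" "B \<in> unitary_group n"
  shows "A * B \<in> unitary_group n"
proof -
  note A = unitary_groupD[OF assms(1)] and B = unitary_groupD[OF assms(2)]
  have "cnj_mat (A * B)\<^sup>T * (A * B) = (cnj_mat B)\<^sup>T * ((cnj_mat A)\<^sup>T * (A * B))"
    by (simp add: mat_monoid A(1,2) B(1,2))
  also have "\<dots> = 1\<^sub>m n"
    by (simp only: unitary_cancel(1)[OF assms(1) B(1)] index_mult_mat B(3))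
  finally show ?thesis
    using A(1,2) B(1,2) unfolding mem_unitary_group_iff by auto
qed

section \<open>Takagi factorization of complex symmetric matrices\<close>

text \<open>Complete \<open>v\<close> to a basis and orthogonalize; Gram-Schmidt keeps the first
  vector, and normalizing only rescales it. That the scalar \<open>c\<close> is real matters later:
  a real multiple of a con-eigenvector keeps its value, whereas a phase would rotate it.\<close>

lemma unitary_first_column:
  fixes v :: "complex vec"
  assumes v: "v \<in> carrier_vec n" and v0: "v \<noteq> 0\<^sub>v n"
  obtains W c where "W \<in> unitary_group n" "col W 0 = complex_of_real c \<cdot>\<^sub>v v"
proof -
  interpret cof_vec_space n "TYPE(complex)" .
  define us where "us = gram_schmidt n (basis_completion v)"
  note bc = basis_completion[OF v v0]
  note gs = gram_schmidt_result[OF bc(2) bc(4) bc(5) us_def]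
  have len: "length us = n" using gs bc by simp
  have n: "n \<noteq> 0" using v v0 by (metis carrier_vecD eq_vecI index_zero_vec(2) less_nat_zero_code)
  have carr: "us ! i \<in> carrier_vec n" if "i < n" for i
    using gs(3) that len by auto
  have hd: "us ! 0 = v"
  proof -
    obtain ws where ws: "basis_completion v = v # ws"
      using bc(6,7) n by (cases "basis_completion v") auto
    have "hd us = v" unfolding us_def ws using v by simp
    then show ?thesis using len n by (cases us) auto
  qed
  \<comment> \<open>The vectors are orthogonal but not yet of length one, so \<open>c i\<close> is
    the reciprocal of the norm of \<open>us ! i\<close>.\<close>
  define c where "c = (\<lambda>i. 1 / sqrt (Re (us ! i \<bullet>c us ! i)))"
  define W where "W = mat n n (\<lambda>(i, j). complex_of_real (c j) * us ! j $ i)"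
  have cc: "complex_of_real (c i) * complex_of_real (c i) * (us ! i \<bullet>c us ! i) = 1" if i: "i < n" for i
  proof -
    have "us ! i \<bullet>c us ! i \<ge> 0" by (rule conjugate_square_ge_0_vec)
    moreover have "us ! i \<bullet>c us ! i \<noteq> 0"
      using corthogonalD[OF gs(2), of i i] i len by simp
    ultimately obtain r where r: "us ! i \<bullet>c us ! i = complex_of_real r" "r > 0"
      by (cases "us ! i \<bullet>c us ! i") (auto simp: less_eq_complex_def complex_eq_iff)
    then have "c i * c i * r = 1" by (simp add: c_def)
    from arg_cong[OF this, of complex_of_real] show ?thesis
      unfolding r(1) by simp
  qed
  have "cnj_mat W\<^sup>T * W = 1\<^sub>m n"
  proof (rule eq_matI)
    fix i j assume "i < dim_row (1\<^sub>m n :: complex mat)" "j < dim_col (1\<^sub>m n :: complex mat)"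
    then have i: "i < n" and j: "j < n" by auto
    have "(cnj_mat W\<^sup>T * W) $$ (i, j) = (\<Sum>k<n. cnj (complex_of_real (c i) * us ! i $ k) * (complex_of_real (c j) * us ! j $ k))"
      using i j by (simp add: W_def scalar_prod_def atLeast0LessThan)
    also have "\<dots> = complex_of_real (c i) * complex_of_real (c j) * (us ! j \<bullet>c us ! i)"
      using carr[OF i] carr[OF j]
      by (simp add: scalar_prod_def atLeast0LessThan sum_distrib_left mult_ac)
    also have "\<dots> = 1\<^sub>m n $$ (i, j)"
    proof (cases "i = j")
      case True then show ?thesis using cc[OF i] i by simp
    next
      case False
      then have "us ! j \<bullet>c us ! i = 0" using corthogonalD[OF gs(2), of j i] i j len by simp
      then show ?thesis using False i j by simp
    qed
    finally show "(cnj_mat W\<^sup>T * W) $$ (i, j) = 1\<^sub>m n $$ (i, j)" .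
  qed (auto simp: W_def)
  then have "W \<in> unitary_group n" by (auto simp: mem_unitary_group_iff W_def)
  moreover have "col W 0 = complex_of_real (c 0) \<cdot>\<^sub>v v"
    using n v hd by (intro eq_vecI) (auto simp: W_def)
  ultimately show thesis by (rule that)
qed

lemma conjugate_mult_mat_vec:
  assumes "X \<in> carrier_mat m n" "v \<in> carrier_vec n"
  shows "conjugate (X *\<^sub>v v) = cnj_mat X *\<^sub>v conjugate v"
  using assms by (intro eq_vecI) (auto simp: scalar_prod_def)

text \<open>The map \<open>T u = X *\<^sub>v conjugate u\<close> is antilinear, but its square is
  the linear map \<open>X * cnj_mat X\<close>, which has an eigenvector. Symmetry of
  \<open>X\<close> makes the eigenvalue a nonnegative real s^2, and real scalars commute with
  \<open>T\<close>, so T^2 - s^2 factors as (T - s)(T + s).\<close>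

lemma con_eigenvector:
  fixes X :: "complex mat"
  assumes X: "X \<in> carrier_mat n n" and sym: "X\<^sup>T = X" and n: "n \<noteq> 0"
  obtains w s where "w \<in> carrier_vec n" "w \<noteq> 0\<^sub>v n"
    "X *\<^sub>v conjugate w = complex_of_real s \<cdot>\<^sub>v w"
proof -
  have XX: "X * cnj_mat X \<in> carrier_mat n n" using X by auto
  obtain as where "char_poly (X * cnj_mat X) = (\<Prod>a\<leftarrow>as. [:- a, 1:])" "length as = n"
    using char_poly_factorized[OF XX] by blast
  with n obtain l where "poly (char_poly (X * cnj_mat X)) l = 0"
    by (cases as) auto
  then obtain v where v: "v \<in> carrier_vec n" "v \<noteq> 0\<^sub>v n" and ev: "X * cnj_mat X *\<^sub>v v = l \<cdot>\<^sub>v v"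
    using eigenvalue_root_char_poly[OF XX, of l] X unfolding eigenvalue_def eigenvector_def by auto
  define T where "T = (\<lambda>u. X *\<^sub>v conjugate u)"
  have T: "T u \<in> carrier_vec n" if "u \<in> carrier_vec n" for u
    using X that by (auto simp: T_def)
  have TT: "T (T v) = l \<cdot>\<^sub>v v"
    using ev X v by (simp add: T_def conjugate_mult_mat_vec[of _ n n] assoc_mult_mat_vec[of _ n n _ n])
  \<comment> \<open>Moving \<open>X\<close> across the bilinear product, which its symmetry permits,
    shows that l |v|^2 = |T v|^2; hence \<open>l\<close> is real and nonnegative.\<close>
  have "l * (v \<bullet>c v) = (X *\<^sub>v conjugate (T v)) \<bullet> conjugate v"
    using TT v by (simp add: T_def)
  also have "\<dots> = conjugate (T v) \<bullet> (X *\<^sub>v conjugate v)"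
    using transpose_vec_mult_scalar[OF X, of "conjugate (T v)" "conjugate v"] v T[OF v(1)] X
      comm_scalar_prod[of "X *\<^sub>v conjugate (T v)" n "conjugate v"]
      comm_scalar_prod[of "conjugate (T v)" n "X *\<^sub>v conjugate v"]
    by (simp add: sym)
  also have "X *\<^sub>v conjugate v = T v" by (simp add: T_def)
  also have "conjugate (T v) \<bullet> T v = T v \<bullet>c T v"
    using T[OF v(1)] by (intro comm_scalar_prod[of _ n]) auto
  finally have eq: "l * (v \<bullet>c v) = T v \<bullet>c T v" .
  have "v \<bullet>c v > 0" using v by simp
  moreover have "T v \<bullet>c T v \<ge> 0" by (rule conjugate_square_ge_0_vec)
  ultimately have "Re (v \<bullet>c v) > 0" "Im (v \<bullet>c v) = 0" "Re (T v \<bullet>c T v) \<ge> 0" "Im (T v \<bullet>c T v) = 0"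
    by (auto simp: less_eq_complex_def less_complex_def)
  with eq have "Im l = 0" "Re l * Re (v \<bullet>c v) \<ge> 0"
    by (auto simp: complex_eq_iff)
  then have "Re l \<ge> 0"
    using \<open>Re (v \<bullet>c v) > 0\<close> by (simp add: zero_le_mult_iff)
  define s where "s = sqrt (Re l)"
  have l: "l = complex_of_real s * complex_of_real s"
    using \<open>Im l = 0\<close> \<open>Re l \<ge> 0\<close> by (simp add: s_def complex_eq_iff)
  \<comment> \<open>Since (T - s)(T + s) v = 0, either (T + s) v vanishes and \<open>v\<close>
    itself serves with value -s, or (T + s) v is a con-eigenvector with value s.\<close>
  show thesis
  proof (cases "T v = complex_of_real (- s) \<cdot>\<^sub>v v")
    case True
    then show thesis using that[OF v, of "- s"] by (simp add: T_def)
  next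
    case False
    define w where "w = T v + complex_of_real s \<cdot>\<^sub>v v"
    have w: "w \<in> carrier_vec n" unfolding w_def using T[OF v(1)] v(1) by auto
    moreover have "w \<noteq> 0\<^sub>v n"
    proof
      assume "w = 0\<^sub>v n"
      have "T v $ i = - complex_of_real s * v $ i" if "i < n" for i
        using arg_cong[OF \<open>w = 0\<^sub>v n\<close>, of "\<lambda>u. u $ i"] v T[OF v(1)] that
        by (simp add: w_def eq_neg_iff_add_eq_0)
      then have "T v = complex_of_real (- s) \<cdot>\<^sub>v v"
        using v T[OF v(1)] by (intro eq_vecI) auto
      with False show False by simp
    qed
    moreover have "X *\<^sub>v conjugate w = T (T v) + complex_of_real s \<cdot>\<^sub>v T v"
      using X v T[OF v(1)]
      by (simp add: w_def T_def conjugate_add_vec[of _ n] conjugate_smult_vec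
          mult_add_distrib_mat_vec[of _ n n] mult_mat_vec[of _ n n])
    then have "X *\<^sub>v conjugate w = complex_of_real s \<cdot>\<^sub>v w"
      using TT v T[OF v(1)]
      by (intro eq_vecI) (auto simp: w_def l algebra_simps)
    ultimately show thesis by (rule that)
  qed
qed

lemma mat_diag_Suc:
  "mat_diag (Suc n) (case_nat a f) =
     four_block_mat (mat_diag 1 (\<lambda>_. a)) (0\<^sub>m 1 n) (0\<^sub>m n 1) (mat_diag n f)"
  by (rule eq_matI) (auto simp: mat_diag_def split: nat.split)

text \<open>Induction by deflation: a con-eigenvector is made the first column of a unitary matrix,
  and the corresponding congruence splits off one diagonal entry.\<close>

lemma takagi:
  assumes "X \<in> carrier_mat n n" "X\<^sup>T = X"
  shows "\<exists>W s. W \<in> unitary_group n \<and> X = W * mat_diag n (\<lambda>a. complex_of_real (s a)) * W\<^sup>T"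
  using assms
proof (induction n arbitrary: X)
  case 0
  then have "X = 1\<^sub>m 0 * mat_diag 0 (\<lambda>a. complex_of_real 0) * (1\<^sub>m 0)\<^sup>T"
    by (intro eq_matI) auto
  moreover have "1\<^sub>m 0 \<in> unitary_group 0" by (auto simp: mem_unitary_group_iff intro!: eq_matI)
  ultimately show ?case by (intro exI[of _ "1\<^sub>m 0"] exI[of _ "\<lambda>_. 0"]) simp
next
  case (Suc n)
  note X = Suc.prems(1) and sym = Suc.prems(2)
  obtain w s where w: "w \<in> carrier_vec (Suc n)" "w \<noteq> 0\<^sub>v (Suc n)"
    and ev: "X *\<^sub>v conjugate w = complex_of_real s \<cdot>\<^sub>v w"
    using con_eigenvector[OF X sym] by auto
  obtain W c where WU: "W \<in> unitary_group (Suc n)" and col: "col W 0 = complex_of_real c \<cdot>\<^sub>v w"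
    using unitary_first_column[OF w] by auto
  note W = unitary_groupD[OF WU]
  have Wc: "W \<in> carrier_mat (Suc n) (Suc n)" using W by auto
  have Wc': "cnj_mat W \<in> carrier_mat (Suc n) (Suc n)" "(cnj_mat W)\<^sup>T \<in> carrier_mat (Suc n) (Suc n)"
    using W by auto
  \<comment> \<open>A congruence with the conjugate of \<open>W\<close>, not a similarity: this
    preserves symmetry and sends a con-eigenvector in the first column to a multiple of the first
    unit vector.\<close>
  define Y where "Y = (cnj_mat W)\<^sup>T * (X * cnj_mat W)"
  have Y: "Y \<in> carrier_mat (Suc n) (Suc n)" using Wc' X by (auto simp: Y_def)
  have dX: "dim_row X = Suc n" "dim_col X = Suc n" using X by auto
  have Ysym: "Y\<^sup>T = Y" using W(1,2) dX sym by (simp add: Y_def mat_monoid)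
  have colX: "col (X * cnj_mat W) 0 = complex_of_real s \<cdot>\<^sub>v col W 0"
  proof -
    have "col (cnj_mat W) 0 = conjugate (col W 0)"
      using W(1,2) by (intro eq_vecI) auto
    also have "\<dots> = complex_of_real c \<cdot>\<^sub>v conjugate w"
      using w by (simp add: col conjugate_smult_vec)
    finally have "col (X * cnj_mat W) 0 = X *\<^sub>v (complex_of_real c \<cdot>\<^sub>v conjugate w)"
      by (subst col_mult2[OF X Wc'(1)]) auto
    also have "\<dots> = complex_of_real c \<cdot>\<^sub>v (complex_of_real s \<cdot>\<^sub>v w)"
      using X w ev by (simp add: mult_mat_vec[of _ "Suc n" "Suc n"])
    finally show ?thesis using w by (simp add: col smult_smult_assoc mult.commute)
  qed
  have colY: "col Y 0 = complex_of_real s \<cdot>\<^sub>v col (1\<^sub>m (Suc n)) 0"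
  proof -
    have "col Y 0 = (cnj_mat W)\<^sup>T *\<^sub>v (complex_of_real s \<cdot>\<^sub>v col W 0)"
      unfolding Y_def colX[symmetric]
      by (rule col_mult2[of _ "Suc n" "Suc n" _ "Suc n"]) (use X Wc' in auto)
    also have "\<dots> = complex_of_real s \<cdot>\<^sub>v ((cnj_mat W)\<^sup>T *\<^sub>v col W 0)"
      by (rule mult_mat_vec[OF Wc'(2)]) (use Wc in \<open>intro col_carrier_vec, simp_all\<close>)
    also have "(cnj_mat W)\<^sup>T *\<^sub>v col W 0 = col ((cnj_mat W)\<^sup>T * W) 0"
      by (rule col_mult2[symmetric, OF Wc'(2) Wc]) simp
    finally show ?thesis unfolding W(3) .
  qed
  have Y0: "Y $$ (i, 0) = (if i = 0 then complex_of_real s else 0)" if "i < Suc n" for i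
    using arg_cong[OF colY, of "\<lambda>v. v $ i"] that Y by auto
  have Y0': "Y $$ (0, i) = (if i = 0 then complex_of_real s else 0)" if "i < Suc n" for i
    using Y0[OF that] arg_cong[OF Ysym, of "\<lambda>A. A $$ (0, i)"] that Y by auto
  \<comment> \<open>Symmetry has cleared the first row together with the first column, so the
    remaining block is all that is left, and it is again symmetric.\<close>
  define Z where "Z = mat n n (\<lambda>(i, j). Y $$ (Suc i, Suc j))"
  have "Z\<^sup>T = Z"
  proof (rule eq_matI)
    fix i j assume "i < dim_row Z" "j < dim_col Z"
    then show "Z\<^sup>T $$ (i, j) = Z $$ (i, j)"
      using arg_cong[OF Ysym, of "\<lambda>A. A $$ (Suc i, Suc j)"] Y by (auto simp: Z_def)
  qed (auto simp: Z_def)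
  moreover have Zc: "Z \<in> carrier_mat n n" by (simp add: Z_def)
  ultimately obtain V t where VU: "V \<in> unitary_group n"
    and Z: "Z = V * mat_diag n (\<lambda>a. complex_of_real (t a)) * V\<^sup>T"
    using Suc.IH by blast
  note V = unitary_groupD[OF VU]
  define B where "B = four_block_mat (1\<^sub>m 1) (0\<^sub>m 1 n) (0\<^sub>m n 1) V"
  define D where "D = mat_diag (Suc n) (\<lambda>a. complex_of_real (case_nat s t a))"
  have D: "D = four_block_mat (mat_diag 1 (\<lambda>_. complex_of_real s)) (0\<^sub>m 1 n) (0\<^sub>m n 1)
      (mat_diag n (\<lambda>a. complex_of_real (t a)))"
    unfolding D_def mat_diag_Suc[symmetric] by (rule arg_cong[of _ _ "mat_diag _"]) (auto split: nat.split)
  note blk = mult_four_block_mat[of _ 1 1 _ n _ n _ _ 1 _ n]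
  have BT: "B\<^sup>T = four_block_mat (1\<^sub>m 1) (0\<^sub>m 1 n) (0\<^sub>m n 1) V\<^sup>T"
    unfolding B_def using V by (subst transpose_four_block_mat[of _ 1 1 _ n _ n]) auto
  have cBT: "(cnj_mat B)\<^sup>T = four_block_mat (1\<^sub>m 1) (0\<^sub>m 1 n) (0\<^sub>m n 1) (cnj_mat V)\<^sup>T"
    unfolding map_mat_transpose BT using V by (intro eq_matI) auto
  have "(cnj_mat B)\<^sup>T * B = 1\<^sub>m (Suc n)"
    unfolding cBT unfolding B_def using V four_block_one_mat[of 1 n] by (subst blk) auto
  then have BU: "B \<in> unitary_group (Suc n)"
    using V by (auto simp: mem_unitary_group_iff B_def map_mat_transpose)
  have Vc: "V \<in> carrier_mat n n" "V * mat_diag n (\<lambda>a. complex_of_real (t a)) * V\<^sup>T \<in> carrier_mat n n" "V * mat_diag n (\<lambda>a. complex_of_real (t a)) \<in> carrier_mat n n"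
    using V(1,2) by (auto intro!: carrier_matI)
  have BD: "B * D = four_block_mat (mat_diag 1 (\<lambda>_. complex_of_real s)) (0\<^sub>m 1 n) (0\<^sub>m n 1)
      (V * mat_diag n (\<lambda>a. complex_of_real (t a)))"
    unfolding D unfolding B_def using Vc by (subst blk) auto
  have "B * D * B\<^sup>T = four_block_mat (mat_diag 1 (\<lambda>_. complex_of_real s)) (0\<^sub>m 1 n) (0\<^sub>m n 1) Z"
    unfolding BD BT Z using Vc by (subst blk) auto
  also have "\<dots> = Y"
    using Y Y0 Y0' by (intro eq_matI) (auto simp: Z_def mat_diag_def)
  finally have BDB: "Y = B * D * B\<^sup>T" ..
  note B = unitary_groupD[OF BU]
  have dD: "dim_row D = Suc n" "dim_col D = Suc n" by (auto simp: D_def)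
  have "X = W * Y * W\<^sup>T"
    using W(1,2) dX by (simp add: Y_def mat_monoid unitary_cancel(2)[OF WU] W(6))
  also have "\<dots> = (W * B) * D * (W * B)\<^sup>T"
    using W(1,2) B(1,2) dD by (simp add: BDB mat_monoid)
  finally show ?case
    using unitary_group_mult[OF WU BU] unfolding D_def by blast
qed

section \<open>Quaternionic matrices as complex matrices\<close>

definition swap_mat :: "nat \<Rightarrow> complex mat" where
  "swap_mat n = four_block_mat (0\<^sub>m n n) (1\<^sub>m n) (1\<^sub>m n) (0\<^sub>m n n)"

lemma four_block_mult:
  fixes A1 :: "'a :: semiring_0 mat"
  assumes "A1 \<in> carrier_mat n n" "B1 \<in> carrier_mat n n" "C1 \<in> carrier_mat n n" "D1 \<in> carrier_mat n n"
    "A2 \<in> carrier_mat n n" "B2 \<in> carrier_mat n n" "C2 \<in> carrier_mat n n" "D2 \<in> carrier_mat n n"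
  shows "four_block_mat A1 B1 C1 D1 * four_block_mat A2 B2 C2 D2 =
    four_block_mat (A1 * A2 + B1 * C2) (A1 * B2 + B1 * D2) (C1 * A2 + D1 * C2) (C1 * B2 + D1 * D2)"
  using assms by (rule mult_four_block_mat)

lemma four_block_transpose:
  assumes "A \<in> carrier_mat n n" "B \<in> carrier_mat n n" "C \<in> carrier_mat n n" "D \<in> carrier_mat n n"
  shows "(four_block_mat A B C D)\<^sup>T = four_block_mat A\<^sup>T C\<^sup>T B\<^sup>T D\<^sup>T"
  using assms by (rule transpose_four_block_mat)

lemma four_block_cnj:
  assumes "A \<in> carrier_mat n n" "B \<in> carrier_mat n n" "C \<in> carrier_mat n n" "D \<in> carrier_mat n n"
  shows "cnj_mat (four_block_mat A B C D) = four_block_mat (cnj_mat A) (cnj_mat B) (cnj_mat C) (cnj_mat D)"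
  using assms by (intro eq_matI) auto

lemma four_block_inject:
  assumes "four_block_mat A B C D = four_block_mat A' B' C' D'"
    "A \<in> carrier_mat n n" "B \<in> carrier_mat n n" "C \<in> carrier_mat n n" "D \<in> carrier_mat n n"
    "A' \<in> carrier_mat n n" "B' \<in> carrier_mat n n" "C' \<in> carrier_mat n n" "D' \<in> carrier_mat n n"
  shows "A = A'" "B = B'" "C = C'" "D = D'"
proof -
  have eq: "four_block_mat A B C D $$ (i, j) = four_block_mat A' B' C' D' $$ (i, j)" for i j
    using assms(1) by simp
  show "A = A'"
  proof (rule eq_matI)
    fix i j assume "i < dim_row A'" "j < dim_col A'"
    then show "A $$ (i, j) = A' $$ (i, j)" using eq[of i j] assms(2-) by simp
  qed (use assms in auto)
  show "B = B'"
  proof (rule eq_matI)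
    fix i j assume "i < dim_row B'" "j < dim_col B'"
    then show "B $$ (i, j) = B' $$ (i, j)" using eq[of i "n + j"] assms(2-) by simp
  qed (use assms in auto)
  show "C = C'"
  proof (rule eq_matI)
    fix i j assume "i < dim_row C'" "j < dim_col C'"
    then show "C $$ (i, j) = C' $$ (i, j)" using eq[of "n + i" j] assms(2-) by simp
  qed (use assms in auto)
  show "D = D'"
  proof (rule eq_matI)
    fix i j assume "i < dim_row D'" "j < dim_col D'"
    then show "D $$ (i, j) = D' $$ (i, j)" using eq[of "n + i" "n + j"] assms(2-) by simp
  qed (use assms in auto)
qed

lemma swap_mat_left:
  assumes "A \<in> carrier_mat n n" "B \<in> carrier_mat n n" "C \<in> carrier_mat n n" "D \<in> carrier_mat n n"
  shows "swap_mat n * four_block_mat A B C D = four_block_mat C D A B"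
  unfolding swap_mat_def using assms by (subst four_block_mult[of _ n]) auto

lemma swap_mat_right:
  assumes "A \<in> carrier_mat n n" "B \<in> carrier_mat n n" "C \<in> carrier_mat n n" "D \<in> carrier_mat n n"
  shows "four_block_mat A B C D * swap_mat n = four_block_mat B A D C"
  unfolding swap_mat_def using assms by (subst four_block_mult[of _ n]) auto

lemma signature_mat_left:
  assumes "A \<in> carrier_mat n n" "B \<in> carrier_mat n n" "C \<in> carrier_mat n n" "D \<in> carrier_mat n n"
  shows "signature_mat n * four_block_mat A B C D = four_block_mat A B (- C) (- D)"
  unfolding signature_mat_def using assms by (subst four_block_mult[of _ n]) auto

lemma signature_mat_right:
  assumes "A \<in> carrier_mat n n" "B \<in> carrier_mat n n" "C \<in> carrier_mat n n" "D \<in> carrier_mat n n"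
  shows "four_block_mat A B C D * signature_mat n = four_block_mat A (- B) C (- D)"
  unfolding signature_mat_def using assms by (subst four_block_mult[of _ n]) auto

lemma swap_mat_props [simp]:
  "dim_row (swap_mat n) = n + n" "dim_col (swap_mat n) = n + n"
  "(swap_mat n)\<^sup>T = swap_mat n" "cnj_mat (swap_mat n) = swap_mat n"
  "swap_mat n * swap_mat n = 1\<^sub>m (n + n)"
proof -
  show "(swap_mat n)\<^sup>T = swap_mat n"
    unfolding swap_mat_def by (subst four_block_transpose[of _ n]) auto
  show "cnj_mat (swap_mat n) = swap_mat n"
    unfolding swap_mat_def by (rule eq_matI) auto
  show "swap_mat n * swap_mat n = 1\<^sub>m (n + n)"
    by (subst (2) swap_mat_def, subst swap_mat_left) auto
qed (auto simp: swap_mat_def)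

lemma signature_mat_props [simp]:
  "dim_row (signature_mat n) = n + n" "dim_col (signature_mat n) = n + n"
  "(signature_mat n)\<^sup>T = signature_mat n" "cnj_mat (signature_mat n) = signature_mat n"
  "signature_mat n * signature_mat n = 1\<^sub>m (n + n)"
proof -
  show "(signature_mat n)\<^sup>T = signature_mat n"
    unfolding signature_mat_def by (subst four_block_transpose[of _ n]) (auto simp: transpose_uminus)
  show "cnj_mat (signature_mat n) = signature_mat n"
    unfolding signature_mat_def by (rule eq_matI) auto
  have "- 0\<^sub>m n n = (0\<^sub>m n n :: complex mat)" by (rule eq_matI) auto
  then show "signature_mat n * signature_mat n = 1\<^sub>m (n + n)"
    by (subst (2) signature_mat_def, subst signature_mat_left) auto
qed (auto simp: signature_mat_def)

section \<open>Complexification as an injective ring homomorphism\<close>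

lemma quat_component_sum:
  "qRe (sum f A) = (\<Sum>a\<in>A. qRe (f a))" "qIm1 (sum f A) = (\<Sum>a\<in>A. qIm1 (f a))"
  "qIm2 (sum f A) = (\<Sum>a\<in>A. qIm2 (f a))" "qIm3 (sum f A) = (\<Sum>a\<in>A. qIm3 (f a))"
  by (induction A rule: infinite_finite_induct) (simp_all add: zero_quat_def plus_quat_def)

text \<open>With q = a + b j for complex a and b, \<open>complexify\<close> sends q to the block
  matrix with rows (a, b) and (-conj b, conj a), and the rule j a = conj(a) j is what makes it
  multiplicative. The check is done on real components.\<close>

lemma complexify_mult:
  assumes "A \<in> carrier_mat n n" "B \<in> carrier_mat n n"
  shows "complexify (A * B) = complexify A * complexify B"
proof -
  have r1: "row A i \<bullet> col B j = (\<Sum>k<n. A $$ (i, k) * B $$ (k, j))" if "i < n" "j < n" for i j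
    using that assms by (simp add: scalar_prod_def atLeast0LessThan)
  have r2: "row (map_mat f A) i \<bullet> col (map_mat g B) j = (\<Sum>k<n. f (A $$ (i, k)) * g (B $$ (k, j)))"
    if "i < n" "j < n" for i j and f g :: "quat \<Rightarrow> complex"
    using that assms by (simp add: scalar_prod_def atLeast0LessThan)
  show ?thesis
    using assms unfolding complexify_def four_block_mult[OF map_carrier_mat[THEN iffD2, OF assms(1)]
        map_carrier_mat[THEN iffD2, OF assms(1)] map_carrier_mat[THEN iffD2, OF assms(1)]
        map_carrier_mat[THEN iffD2, OF assms(1)] map_carrier_mat[THEN iffD2, OF assms(2)]
        map_carrier_mat[THEN iffD2, OF assms(2)] map_carrier_mat[THEN iffD2, OF assms(2)]
        map_carrier_mat[THEN iffD2, OF assms(2)]]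
    by (intro cong_four_block_mat eq_matI)
      (simp_all add: r1 r2 complex_eq_iff quat_component_sum times_quat_def sum.distrib sum_subtractf
        sum_negf algebra_simps del: col_map_mat)
qed

lemma complexify_one: "complexify (1\<^sub>m n) = 1\<^sub>m (n + n)"
  by (rule eq_matI) (auto simp: complexify_def one_quat_def zero_quat_def complex_eq_iff)

lemma complexify_inject:
  assumes "complexify A = complexify B" "A \<in> carrier_mat n n" "B \<in> carrier_mat n n"
  shows "A = B"
proof -
  note eq = four_block_inject(1,2)[OF assms(1)[unfolded complexify_def], of n]
  have 1: "map_mat (\<lambda>q. Complex (qRe q) (qIm1 q)) A = map_mat (\<lambda>q. Complex (qRe q) (qIm1 q)) B"
    and 2: "map_mat (\<lambda>q. Complex (qIm2 q) (qIm3 q)) A = map_mat (\<lambda>q. Complex (qIm2 q) (qIm3 q)) B"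
    using eq assms(2,3) by auto
  show ?thesis
  proof (rule eq_matI)
    fix i j assume ij: "i < dim_row B" "j < dim_col B"
    show "A $$ (i, j) = B $$ (i, j)"
      using arg_cong[OF 1, of "\<lambda>M. M $$ (i, j)"] arg_cong[OF 2, of "\<lambda>M. M $$ (i, j)"] ij assms(2,3)
      by (auto intro!: quat.expand)
  qed (use assms in auto)
qed

lemma complexify_carrier: "A \<in> carrier_mat n n \<Longrightarrow> complexify A \<in> carrier_mat (n + n) (n + n)"
  by (simp add: complexify_def)

text \<open>Quaternion conjugation negates all three imaginary parts, and conjugation by i negates
  the j and k parts once more, so only the i part changes sign: in q = a + b j, a becomes conj(a)
  and b stays. Exchanging block rows and block columns of the transpose has the same effect.\<close>

lemma complexify_quat_adjoint_i:
  assumes "V \<in> carrier_mat n n"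
  shows "complexify (quat_adjoint_i V) = swap_mat n * ((complexify V)\<^sup>T * swap_mat n)"
proof -
  have 1: "- (quat_i * quat_cnj q * quat_i) = Quat (qRe q) (- qIm1 q) (qIm2 q) (qIm3 q)" for q
    by (simp add: quat_i_def quat_cnj_def times_quat_def uminus_quat_def)
  show ?thesis
    unfolding complexify_def using assms
    by (subst four_block_transpose[of _ n], simp_all, subst swap_mat_right, simp_all,
        subst swap_mat_left, simp_all)
      (auto intro!: cong_four_block_mat eq_matI simp: quat_adjoint_i_def quat_adjoint_def 1)
qed

text \<open>Complexification turns orthogonality into S C^T S C = 1. For square matrices the factors
  of this product can be exchanged, and S is its own inverse. The resulting form with C on the left
  is the one that cancels inside U S U^T.\<close>

lemma quat_orthogonal_iff:
  assumes V: "V \<in> carrier_mat n n"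
  shows "V \<in> quat_orthogonal n \<longleftrightarrow>
    complexify V * (swap_mat n * (complexify V)\<^sup>T) = swap_mat n"
proof -
  define C where "C = complexify V"
  have C: "dim_row C = n + n" "dim_col C = n + n"
    using complexify_carrier[OF V] by (auto simp: C_def)
  have C': "swap_mat n * (C\<^sup>T * swap_mat n) \<in> carrier_mat (n + n) (n + n)" "C \<in> carrier_mat (n + n) (n + n)"
    using C by (auto intro!: carrier_matI)
  have V': "quat_adjoint_i V \<in> carrier_mat n n"
    using V by (auto simp: quat_adjoint_i_def quat_adjoint_def)
  have "V \<in> quat_orthogonal n \<longleftrightarrow> quat_adjoint_i V * V = 1\<^sub>m n"
    using V by (simp add: quat_orthogonal_def)
  also have "\<dots> \<longleftrightarrow> complexify (quat_adjoint_i V * V) = complexify (1\<^sub>m n)"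
    using complexify_inject[of "quat_adjoint_i V * V" "1\<^sub>m n" n] V V' by auto
  also have "\<dots> \<longleftrightarrow> (swap_mat n * (C\<^sup>T * swap_mat n)) * C = 1\<^sub>m (n + n)"
    using V V' by (simp add: complexify_mult complexify_one complexify_quat_adjoint_i C_def)
  also have "\<dots> \<longleftrightarrow> C * (swap_mat n * (C\<^sup>T * swap_mat n)) = 1\<^sub>m (n + n)"
    using mat_inverse_commute[OF _ C'] mat_inverse_commute[OF _ C'(2,1)] by blast
  also have "\<dots> \<longleftrightarrow> C * (swap_mat n * C\<^sup>T) = swap_mat n" (is "?L = 1\<^sub>m _ \<longleftrightarrow> ?R = _")
  proof
    have "?L * swap_mat n = ?R"
      using C by (simp add: mat_assoc)
    then show "?R = swap_mat n" if "?L = 1\<^sub>m (n + n)"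
      unfolding that by simp
    have "?L = ?R * swap_mat n"
      using C by (simp add: mat_assoc)
    then show "?L = 1\<^sub>m (n + n)" if "?R = swap_mat n"
      unfolding that by simp
  qed
  finally show ?thesis by (simp add: C_def)
qed

section \<open>The indefinite unitary group\<close>

lemma mem_indefinite_unitary_group_iff:
  "G \<in> indefinite_unitary_group n \<longleftrightarrow>
     dim_row G = n + n \<and> dim_col G = n + n \<and> (cnj_mat G)\<^sup>T * (signature_mat n * G) = signature_mat n"
proof -
  have "mat_adjoint G * signature_mat n * G = (cnj_mat G)\<^sup>T * (signature_mat n * G)"
    if "dim_row G = n + n" "dim_col G = n + n"
    using that by (simp add: mat_adjoint_eq mat_monoid)
  then show ?thesis by (auto simp: indefinite_unitary_group_def mult_2)
qed

text \<open>The defining relation exhibits I_{n,n} G^H I_{n,n} as a left inverse, hence a two-sided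
  one. The last identity says that the group is closed under conjugate transposition.\<close>

lemma indefinite_unitary_inverse:
  assumes "G \<in> indefinite_unitary_group n"
  defines "N \<equiv> signature_mat n * ((cnj_mat G)\<^sup>T * signature_mat n)"
  shows "N * G = 1\<^sub>m (n + n)" "G * N = 1\<^sub>m (n + n)"
    "dim_row N = n + n" "dim_col N = n + n"
    "G * (signature_mat n * (cnj_mat G)\<^sup>T) = signature_mat n"
proof -
  have G: "dim_row G = n + n" "dim_col G = n + n"
    and eq: "(cnj_mat G)\<^sup>T * (signature_mat n * G) = signature_mat n"
    using assms by (auto simp: mem_indefinite_unitary_group_iff)
  show d: "dim_row N = n + n" "dim_col N = n + n" using G by (auto simp: N_def)
  show 1: "N * G = 1\<^sub>m (n + n)"
    using G eq by (simp add: N_def mat_assoc)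
  then show 2: "G * N = 1\<^sub>m (n + n)"
    by (rule mat_inverse_commute) (use G d in \<open>auto intro: carrier_matI\<close>)
  have "G * (signature_mat n * (cnj_mat G)\<^sup>T) = (G * N) * signature_mat n"
    using G by (simp add: N_def mat_assoc)
  then show "G * (signature_mat n * (cnj_mat G)\<^sup>T) = signature_mat n"
    unfolding 2 by simp
qed

text \<open>The inverse of \<open>C\<close> is both I_{n,n} C^H I_{n,n} and S C^T S. Comparing
  blocks gives d = conj(a) and c = -conj(b), exactly the shape of a complexified matrix.\<close>

lemma complexify_surj:
  assumes U: "C \<in> indefinite_unitary_group n"
    and S: "C * (swap_mat n * C\<^sup>T) = swap_mat n"
  obtains V where "V \<in> quat_orthogonal n" "complexify V = C"
proof -
  note N = indefinite_unitary_inverse[OF U]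
  have C: "dim_row C = n + n" "dim_col C = n + n"
    using U by (auto simp: mem_indefinite_unitary_group_iff)
  obtain a b c d where "split_block C n n = (a, b, c, d)" by (metis prod_cases4)
  note blocks = split_block[OF this C]
  \<comment> \<open>The unitary inverse is applied to C S C^T S, which equals 1 by \<open>S\<close>;
    this identifies the two forms of the inverse.\<close>
  have "signature_mat n * ((cnj_mat C)\<^sup>T * signature_mat n) * (C * (swap_mat n * C\<^sup>T) * swap_mat n)
      = swap_mat n * (C\<^sup>T * swap_mat n)"
    using mat_inverse_cancel[OF N(1), of "swap_mat n * (C\<^sup>T * swap_mat n)"] C N(3,4)
    by (simp add: mat_assoc)
  then have "signature_mat n * ((cnj_mat C)\<^sup>T * signature_mat n) = swap_mat n * (C\<^sup>T * swap_mat n)"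
    unfolding S using C by (simp add: mat_assoc)
  also have "C\<^sup>T = four_block_mat a\<^sup>T c\<^sup>T b\<^sup>T d\<^sup>T"
    unfolding blocks(5) using blocks by (intro four_block_transpose) auto
  also have "swap_mat n * (\<dots> * swap_mat n) = four_block_mat d\<^sup>T b\<^sup>T c\<^sup>T a\<^sup>T"
    using blocks by (simp add: swap_mat_left swap_mat_right)
  finally have "four_block_mat d\<^sup>T b\<^sup>T c\<^sup>T a\<^sup>T =
      signature_mat n * ((cnj_mat C)\<^sup>T * signature_mat n)" ..
  also have "(cnj_mat C)\<^sup>T =
      four_block_mat (cnj_mat a)\<^sup>T (cnj_mat c)\<^sup>T (cnj_mat b)\<^sup>T (cnj_mat d)\<^sup>T"
    unfolding blocks(5) using blocks by (simp add: four_block_cnj four_block_transpose)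
  also have "signature_mat n * (\<dots> * signature_mat n) =
      four_block_mat (cnj_mat a)\<^sup>T (- (cnj_mat c)\<^sup>T) (- (cnj_mat b)\<^sup>T) (- (- (cnj_mat d)\<^sup>T))"
    using blocks by (simp add: signature_mat_left signature_mat_right)
  finally have eq: "four_block_mat d\<^sup>T b\<^sup>T c\<^sup>T a\<^sup>T =
      four_block_mat (cnj_mat a)\<^sup>T (- (cnj_mat c)\<^sup>T) (- (cnj_mat b)\<^sup>T) (- (- (cnj_mat d)\<^sup>T))" .
  have d: "d = cnj_mat a" and c: "c\<^sup>T = - (cnj_mat b)\<^sup>T"
    using four_block_inject(1,3)[OF eq, of n] blocks by (auto simp: transpose_mat_eq)
  have c: "c = - cnj_mat b"
    using arg_cong[OF c, of transpose_mat] by (simp add: transpose_uminus)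
  define V where "V = mat n n (\<lambda>ij. Quat (Re (a $$ ij)) (Im (a $$ ij)) (Re (b $$ ij)) (Im (b $$ ij)))"
  have V: "V \<in> carrier_mat n n" by (simp add: V_def)
  have "complexify V = C"
    unfolding blocks(5) complexify_def d c using blocks
    by (intro cong_four_block_mat eq_matI) (auto simp: V_def complex_eq_iff)
  then show thesis using that quat_orthogonal_iff[OF V] S by blast
qed

section \<open>The complex symmetric matrix of a coset\<close>

lemma dim_Ch_Sh [simp]:
  "dim_row (Ch n \<theta>) = n" "dim_col (Ch n \<theta>) = n" "dim_row (Sh n \<theta>) = n" "dim_col (Sh n \<theta>) = n"
  by (simp_all add: Ch_def Sh_def)

lemma Ch_Sh_props [simp]:
  "(Ch n \<theta>)\<^sup>T = Ch n \<theta>" "cnj_mat (Ch n \<theta>) = Ch n \<theta>"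
  "(Sh n \<theta>)\<^sup>T = Sh n \<theta>" "cnj_mat (Sh n \<theta>) = Sh n \<theta>"
  by (simp_all add: Ch_def Sh_def)

section \<open>Double angles and the factor diag(U1, U2) A\<close>

lemma mat_diag_sandwich_add:
  fixes A B :: "'a :: comm_ring_1 mat"
  assumes "A \<in> carrier_mat m n" "B \<in> carrier_mat n k"
  shows "A * (mat_diag n f * B) + A * (mat_diag n g * B) = A * (mat_diag n (\<lambda>i. f i + g i) * B)"
proof -
  have "A * (mat_diag n f * B) + A * (mat_diag n g * B) = A * (mat_diag n f * B + mat_diag n g * B)"
    by (rule mult_add_distrib_mat[symmetric]) (use assms in auto)
  also have "mat_diag n f * B + mat_diag n g * B = (mat_diag n f + mat_diag n g) * B"
    by (rule add_mult_distrib_mat[symmetric]) (use assms in auto)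
  also have "mat_diag n f + mat_diag n g = mat_diag n (\<lambda>i. f i + g i)"
    by (rule eq_matI) (auto simp: mat_diag_def)
  finally show ?thesis .
qed

text \<open>Double-angle formulas inside right-nested products. Both orders of the summands are
  listed because block multiplication produces both.\<close>

lemma hyperbolic_double:
  assumes "A \<in> carrier_mat m n" "B \<in> carrier_mat n k"
  shows "A * (Ch n \<theta> * (Sh n \<theta> * B)) + A * (Sh n \<theta> * (Ch n \<theta> * B)) = A * (Sh n (\<lambda>a. 2 * \<theta> a) * B)"
    "A * (Sh n \<theta> * (Ch n \<theta> * B)) + A * (Ch n \<theta> * (Sh n \<theta> * B)) = A * (Sh n (\<lambda>a. 2 * \<theta> a) * B)"
    "A * (Ch n \<theta> * (Ch n \<theta> * B)) + A * (Sh n \<theta> * (Sh n \<theta> * B)) = A * (Ch n (\<lambda>a. 2 * \<theta> a) * B)"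
    "A * (Sh n \<theta> * (Sh n \<theta> * B)) + A * (Ch n \<theta> * (Ch n \<theta> * B)) = A * (Ch n (\<lambda>a. 2 * \<theta> a) * B)"
proof -
  have sinh: "mat_diag n (\<lambda>i. complex_of_real (cosh (\<theta> i)) * complex_of_real (sinh (\<theta> i)) +
      complex_of_real (sinh (\<theta> i)) * complex_of_real (cosh (\<theta> i))) = Sh n (\<lambda>a. 2 * \<theta> a)"
    "mat_diag n (\<lambda>i. complex_of_real (sinh (\<theta> i)) * complex_of_real (cosh (\<theta> i)) +
      complex_of_real (cosh (\<theta> i)) * complex_of_real (sinh (\<theta> i))) = Sh n (\<lambda>a. 2 * \<theta> a)"
    unfolding Sh_def by (rule arg_cong[of _ _ "mat_diag n"], simp add: fun_eq_iff sinh_double)+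
  have cosh: "mat_diag n (\<lambda>i. complex_of_real (cosh (\<theta> i)) * complex_of_real (cosh (\<theta> i)) +
      complex_of_real (sinh (\<theta> i)) * complex_of_real (sinh (\<theta> i))) = Ch n (\<lambda>a. 2 * \<theta> a)"
    "mat_diag n (\<lambda>i. complex_of_real (sinh (\<theta> i)) * complex_of_real (sinh (\<theta> i)) +
      complex_of_real (cosh (\<theta> i)) * complex_of_real (cosh (\<theta> i))) = Ch n (\<lambda>a. 2 * \<theta> a)"
    unfolding Ch_def by (rule arg_cong[of _ _ "mat_diag n"], simp add: fun_eq_iff cosh_double power2_eq_square)+
  note simps = mat_diag_diag_left[of B] mat_diag_sandwich_add[OF assms] carrier_matD(1)[OF assms(2)]
  show "A * (Ch n \<theta> * (Sh n \<theta> * B)) + A * (Sh n \<theta> * (Ch n \<theta> * B)) = A * (Sh n (\<lambda>a. 2 * \<theta> a) * B)"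
    "A * (Sh n \<theta> * (Ch n \<theta> * B)) + A * (Ch n \<theta> * (Sh n \<theta> * B)) = A * (Sh n (\<lambda>a. 2 * \<theta> a) * B)"
    by (simp_all only: Ch_def[of n \<theta>] Sh_def[of n \<theta>] simps sinh)
  show "A * (Ch n \<theta> * (Ch n \<theta> * B)) + A * (Sh n \<theta> * (Sh n \<theta> * B)) = A * (Ch n (\<lambda>a. 2 * \<theta> a) * B)"
    "A * (Sh n \<theta> * (Sh n \<theta> * B)) + A * (Ch n \<theta> * (Ch n \<theta> * B)) = A * (Ch n (\<lambda>a. 2 * \<theta> a) * B)"
    by (simp_all only: Ch_def[of n \<theta>] Sh_def[of n \<theta>] simps cosh)
qed

text \<open>The part K A of a decomposition G = K A H: K is the compact group U(n) x U(n), A the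
  abelian group of hyperbolic rotations, and H the complexified quaternionic orthogonal
  group.\<close>

definition KA_mat :: "nat \<Rightarrow> complex mat \<Rightarrow> complex mat \<Rightarrow> (nat \<Rightarrow> real) \<Rightarrow> complex mat" where
  "KA_mat n U1 U2 \<theta> = four_block_mat U1 (0\<^sub>m n n) (0\<^sub>m n n) U2
     * four_block_mat (Ch n \<theta>) (Sh n \<theta>) (Sh n \<theta>) (Ch n \<theta>)"

lemma KA_mat_blocks:
  assumes "U1 \<in> carrier_mat n n" "U2 \<in> carrier_mat n n"
  shows "KA_mat n U1 U2 \<theta> = four_block_mat (U1 * Ch n \<theta>) (U1 * Sh n \<theta>) (U2 * Sh n \<theta>) (U2 * Ch n \<theta>)"
proof -
  have c: "Ch n \<theta> \<in> carrier_mat n n" "Sh n \<theta> \<in> carrier_mat n n"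
    "U1 * Ch n \<theta> \<in> carrier_mat n n" "U1 * Sh n \<theta> \<in> carrier_mat n n"
    "U2 * Ch n \<theta> \<in> carrier_mat n n" "U2 * Sh n \<theta> \<in> carrier_mat n n"
    using assms by (auto intro: carrier_matI)
  show ?thesis
    unfolding KA_mat_def using assms c by (simp add: four_block_mult[of _ n])
qed

text \<open>The hyperbolic factor A is symmetric and commutes with S, so A S A^T = A^2 S; this is
  why the angles appear doubled.\<close>

lemma KA_mat_swap:
  assumes U: "U1 \<in> carrier_mat n n" "U2 \<in> carrier_mat n n"
  shows "KA_mat n U1 U2 \<theta> * (swap_mat n * (KA_mat n U1 U2 \<theta>)\<^sup>T) =
    four_block_mat (U1 * (Sh n (\<lambda>a. 2 * \<theta> a) * U1\<^sup>T)) (U1 * (Ch n (\<lambda>a. 2 * \<theta> a) * U2\<^sup>T))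
      (U2 * (Ch n (\<lambda>a. 2 * \<theta> a) * U1\<^sup>T)) (U2 * (Sh n (\<lambda>a. 2 * \<theta> a) * U2\<^sup>T))"
proof -
  have d: "dim_row U1 = n" "dim_col U1 = n" "dim_row U2 = n" "dim_col U2 = n" using U by auto
  have T: "(KA_mat n U1 U2 \<theta>)\<^sup>T = four_block_mat (Ch n \<theta> * U1\<^sup>T) (Sh n \<theta> * U2\<^sup>T) (Sh n \<theta> * U1\<^sup>T) (Ch n \<theta> * U2\<^sup>T)"
    unfolding KA_mat_blocks[OF U] by (subst four_block_transpose[of _ n]) (auto simp: mat_transpose_mult d)
  have SM: "swap_mat n * (KA_mat n U1 U2 \<theta>)\<^sup>T = four_block_mat (Sh n \<theta> * U1\<^sup>T) (Ch n \<theta> * U2\<^sup>T) (Ch n \<theta> * U1\<^sup>T) (Sh n \<theta> * U2\<^sup>T)"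
    unfolding T by (rule swap_mat_left) (auto simp: d)
  show ?thesis
    unfolding SM unfolding KA_mat_blocks[OF U] using U
    by (subst four_block_mult[of _ n])
      (auto simp: d mat_assoc hyperbolic_double intro!: carrier_matI)
qed

text \<open>The block diagonal factor is unitary and commutes with I_{n,n}; the hyperbolic factor
  preserves I_{n,n} because cosh^2 - sinh^2 = 1.\<close>

lemma KA_mat_indefinite_unitary:
  assumes "U1 \<in> unitary_group n" "U2 \<in> unitary_group n"
  shows "KA_mat n U1 U2 \<theta> \<in> indefinite_unitary_group n"
proof -
  note U1 = unitary_groupD[OF assms(1)] and U2 = unitary_groupD[OF assms(2)]
  note can = unitary_cancel(1)[OF assms(1)] unitary_cancel(1)[OF assms(2)]
  have c: "U1 \<in> carrier_mat n n" "U2 \<in> carrier_mat n n" using U1(1,2) U2(1,2) by auto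
  let ?C = "Ch n \<theta>" and ?S = "Sh n \<theta>"
  have cc: "?C \<in> carrier_mat n n" "?S \<in> carrier_mat n n"
    "U1 * ?C \<in> carrier_mat n n" "U1 * ?S \<in> carrier_mat n n"
    "U2 * ?C \<in> carrier_mat n n" "U2 * ?S \<in> carrier_mat n n"
    "cnj_mat U1 * ?C \<in> carrier_mat n n" "cnj_mat U1 * ?S \<in> carrier_mat n n"
    "cnj_mat U2 * ?C \<in> carrier_mat n n" "cnj_mat U2 * ?S \<in> carrier_mat n n"
    "?C * (cnj_mat U1)\<^sup>T \<in> carrier_mat n n" "?S * (cnj_mat U1)\<^sup>T \<in> carrier_mat n n"
    "?C * (cnj_mat U2)\<^sup>T \<in> carrier_mat n n" "?S * (cnj_mat U2)\<^sup>T \<in> carrier_mat n n"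
    using c by (auto intro: carrier_matI)
  have T: "(cnj_mat (KA_mat n U1 U2 \<theta>))\<^sup>T = four_block_mat (?C * (cnj_mat U1)\<^sup>T) (?S * (cnj_mat U2)\<^sup>T)
      (?S * (cnj_mat U1)\<^sup>T) (?C * (cnj_mat U2)\<^sup>T)"
    unfolding KA_mat_blocks[OF c] using cc U1(1,2) U2(1,2)
    by (simp add: four_block_cnj[of _ n] four_block_transpose[of _ n] mat_monoid)
  have S: "signature_mat n * KA_mat n U1 U2 \<theta> =
      four_block_mat (U1 * ?C) (U1 * ?S) (- (U2 * ?S)) (- (U2 * ?C))"
    unfolding KA_mat_blocks[OF c] by (rule signature_mat_left) (rule cc)+
  have m: "X * (cnj_mat U2)\<^sup>T * (U2 * Y) = X * Y"
    if "X \<in> carrier_mat n n" "Y \<in> carrier_mat n n" for X Y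
  proof -
    have "X * (cnj_mat U2)\<^sup>T * (U2 * Y) = X * ((cnj_mat U2)\<^sup>T * (U2 * Y))"
      by (rule mat_assoc) (use that U2(1,2) in auto)
    also have "(cnj_mat U2)\<^sup>T * (U2 * Y) = Y"
      by (rule can(2)) (use that in auto)
    finally show ?thesis .
  qed
  have p: "X * (cnj_mat U1)\<^sup>T * (U1 * Y) = X * Y"
    if "X \<in> carrier_mat n n" "Y \<in> carrier_mat n n" for X Y
  proof -
    have "X * (cnj_mat U1)\<^sup>T * (U1 * Y) = X * ((cnj_mat U1)\<^sup>T * (U1 * Y))"
      by (rule mat_assoc) (use that U1(1,2) in auto)
    also have "(cnj_mat U1)\<^sup>T * (U1 * Y) = Y"
      by (rule can(1)) (use that in auto)
    finally show ?thesis .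
  qed
  have "(cnj_mat (KA_mat n U1 U2 \<theta>))\<^sup>T * (signature_mat n * KA_mat n U1 U2 \<theta>) =
     four_block_mat (?C * ?C + - (?S * ?S)) (?C * ?S + - (?S * ?C)) (?S * ?C + - (?C * ?S)) (?S * ?S + - (?C * ?C))"
    unfolding T S using cc by (simp add: four_block_mult[of _ n] m p)
  also have "\<dots> = signature_mat n"
    unfolding signature_mat_def
  proof (rule cong_four_block_mat)
    have hyp: "complex_of_real (cosh x) * complex_of_real (cosh x) = 1 + complex_of_real (sinh x) * complex_of_real (sinh x)" for x
      by (metis cosh_square_eq of_real_1 of_real_add of_real_mult power2_eq_square add.commute)
    show "?C * ?C + - (?S * ?S) = 1\<^sub>m n" "?C * ?S + - (?S * ?C) = 0\<^sub>m n n"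
      "?S * ?C + - (?C * ?S) = 0\<^sub>m n n" "?S * ?S + - (?C * ?C) = - 1\<^sub>m n"
      unfolding Ch_def Sh_def mat_diag_diag
      by (auto intro!: eq_matI simp: mat_diag_def hyp)
  qed
  finally show ?thesis
    using c by (simp add: mem_indefinite_unitary_group_iff KA_mat_blocks)
qed

section \<open>Existence of the factorization\<close>

lemma mat_add_uminus_solve:
  fixes A P :: "'a :: ring mat"
  assumes "A + - P = - E" "A \<in> carrier_mat n n" "P \<in> carrier_mat n n" "E \<in> carrier_mat n n"
  shows "P = E + A"
proof (rule eq_matI)
  fix i j assume "i < dim_row (E + A)" "j < dim_col (E + A)"
  then have "(A + - P) $$ (i, j) = A $$ (i, j) - P $$ (i, j)" "(- E) $$ (i, j) = - (E $$ (i, j))"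
    "(E + A) $$ (i, j) = E $$ (i, j) + A $$ (i, j)"
    using assms(2-) by auto
  then show "P $$ (i, j) = (E + A) $$ (i, j)"
    unfolding assms(1) by (simp add: algebra_simps)
qed (use assms in auto)

text \<open>Takagi applied to \<open>X\<close> fixes U1 and the angles. The relation
  \<open>YY\<close> says that \<open>Y\<close> has the same Gram matrix as U1 cosh(2 Theta), so the
  two differ by a unitary factor on the right, whose transpose is U2; \<open>YZ\<close> then
  determines \<open>Z\<close>.\<close>

lemma symmetric_blocks_factorization:
  assumes c: "X \<in> carrier_mat n n" "Y \<in> carrier_mat n n" "Z \<in> carrier_mat n n"
    and sym: "X\<^sup>T = X"
    and YY: "cnj_mat Y * Y\<^sup>T = 1\<^sub>m n + cnj_mat X * X"
    and YZ: "cnj_mat Y * Z = cnj_mat X * Y"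
  obtains U1 U2 \<theta> where "U1 \<in> unitary_group n" "U2 \<in> unitary_group n"
    "X = U1 * (Sh n (\<lambda>a. 2 * \<theta> a) * U1\<^sup>T)" "Y = U1 * (Ch n (\<lambda>a. 2 * \<theta> a) * U2\<^sup>T)"
    "Z = U2 * (Sh n (\<lambda>a. 2 * \<theta> a) * U2\<^sup>T)"
proof -
  obtain W s where WU: "W \<in> unitary_group n"
    and X: "X = W * mat_diag n (\<lambda>a. complex_of_real (s a)) * W\<^sup>T"
    using takagi[OF c(1) sym] by blast
  note W = unitary_groupD[OF WU] and canW = unitary_cancel[OF WU]
  \<comment> \<open>Chosen so that sinh(2 \<theta>) is the Takagi value, whatever its sign.\<close>
  define \<theta> where "\<theta> = (\<lambda>a. arsinh (s a) / 2)"
  define S where "S = Sh n (\<lambda>a. 2 * \<theta> a)"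
  define C where "C = Ch n (\<lambda>a. 2 * \<theta> a)"
  \<comment> \<open>The inverse of \<open>C\<close>, available without case distinction because cosh
    never vanishes on the reals.\<close>
  define D where "D = mat_diag n (\<lambda>a. complex_of_real (1 / cosh (2 * \<theta> a)))"
  have [simp]: "dim_row S = n" "dim_col S = n" "dim_row C = n" "dim_col C = n" "dim_row D = n" "dim_col D = n"
    "S\<^sup>T = S" "C\<^sup>T = C" "cnj_mat S = S" "cnj_mat C = C" "cnj_mat D = D" "D\<^sup>T = D"
    by (auto simp: S_def C_def D_def simp del: of_real_divide)
  have [simp]: "dim_row X = n" "dim_col X = n" "dim_row Y = n" "dim_col Y = n" "dim_row Z = n" "dim_col Z = n"
    using c by auto
  have ch: "cosh (x :: real) \<noteq> 0" for x using cosh_real_pos[of x] by simp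
  have CD: "C * D = 1\<^sub>m n" and DC: "D * C = 1\<^sub>m n"
    unfolding C_def D_def Ch_def mat_diag_diag
    by (auto intro!: eq_matI simp: mat_diag_def ch simp flip: of_real_mult)
  have SC: "S * C = C * S"
    by (simp add: S_def C_def Sh_def Ch_def mult.commute)
  have CCSS: "C * C = mat_diag n (\<lambda>a. 1 + complex_of_real (sinh (2 * \<theta> a)) * complex_of_real (sinh (2 * \<theta> a)))"
    unfolding C_def Ch_def mat_diag_diag
    by (rule arg_cong[of _ _ "mat_diag n"]) (metis (no_types) cosh_square_eq of_real_1 of_real_add of_real_mult power2_eq_square add.commute)
  have X: "X = W * (S * W\<^sup>T)"
    using W(1,2) by (simp add: X S_def \<theta>_def Sh_def sinh_arsinh_real mat_assoc)
  have cX: "cnj_mat X = cnj_mat W * (S * (cnj_mat W)\<^sup>T)"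
    using W(1,2) by (simp add: X mat_monoid)
  have YYc: "Y * (cnj_mat Y)\<^sup>T = W * (C * (C * (cnj_mat W)\<^sup>T))"
  proof -
    have "Y * (cnj_mat Y)\<^sup>T = cnj_mat (cnj_mat Y * Y\<^sup>T)" by (simp add: mat_monoid)
    also have "\<dots> = 1\<^sub>m n + X * cnj_mat X"
      unfolding YY using c(1) by (intro eq_matI) (auto simp: scalar_prod_def cnj_sum)
    also have "X * cnj_mat X = W * (S * (S * (cnj_mat W)\<^sup>T))"
      using W(1,2) by (simp add: cX mat_assoc canW) (simp add: X mat_assoc canW)
    \<comment> \<open>The identity is written as a sandwich between \<open>W\<close> and its inverse
      so that both summands can be merged into one diagonal matrix.\<close>
    also have "1\<^sub>m n = W * (mat_diag n (\<lambda>_. 1) * (cnj_mat W)\<^sup>T)"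
      using W by simp
    also have "W * (mat_diag n (\<lambda>_. 1) * (cnj_mat W)\<^sup>T) + W * (S * (S * (cnj_mat W)\<^sup>T)) =
        W * (C * C * (cnj_mat W)\<^sup>T)"
      unfolding CCSS using W(1,2)
      by (simp only: S_def Sh_def mat_diag_diag_left index_transpose_mat index_map_mat)
        (rule mat_diag_sandwich_add, auto)
    finally show ?thesis using W(1,2) by (simp add: mat_assoc)
  qed
  \<comment> \<open>The solution of Y = W C R. By \<open>YYc\<close> its rows are orthonormal, so
    its transpose can serve as U2.\<close>
  define R where "R = D * ((cnj_mat W)\<^sup>T * Y)"
  have [simp]: "dim_row R = n" "dim_col R = n" using W(1,2) by (auto simp: R_def)
  have "R * (cnj_mat R)\<^sup>T = D * ((cnj_mat W)\<^sup>T * (Y * (cnj_mat Y)\<^sup>T * (W * D)))"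
    using W(1,2) by (simp add: R_def mat_monoid)
  also have "\<dots> = (D * C) * (C * D)"
    unfolding YYc using W by (simp add: mat_assoc canW)
  finally have RR: "R * (cnj_mat R)\<^sup>T = 1\<^sub>m n" by (simp add: CD DC)
  have U2: "R\<^sup>T \<in> unitary_group n"
    using arg_cong[OF RR, of cnj_mat] by (auto simp: mem_unitary_group_iff mat_monoid)
  note canR = unitary_cancel[OF U2, simplified]
  have "C * R = (cnj_mat W)\<^sup>T * Y"
    unfolding R_def by (rule mat_inverse_cancel[OF CD]) (use W(1,2) in auto)
  then have Y: "Y = W * (C * R)" by (simp add: canW)
  \<comment> \<open>Substituting \<open>Y\<close> and \<open>X\<close> into \<open>YZ\<close> and
    cancelling \<open>W\<close> leaves C conj(R) Z = S C R; the diagonal matrices commute, so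
    \<open>C\<close> can be cancelled.\<close>
  have "C * ((cnj_mat R) * Z) = W\<^sup>T * (cnj_mat Y * Z)"
    using W(1,2) by (simp add: Y mat_monoid canW)
  also have "\<dots> = S * (C * R)"
    unfolding YZ using W(1,2) by (simp add: cX mat_assoc canW) (simp add: Y canW)
  also have "\<dots> = C * (S * R)"
    by (simp add: SC flip: mat_assoc)
  finally have "D * (C * ((cnj_mat R) * Z)) = D * (C * (S * R))" by simp
  then have "cnj_mat R * Z = S * R"
    by (simp add: mat_inverse_cancel[OF DC])
  then have "R\<^sup>T * (S * R) = Z"
    using unitary_cancel(2)[OF U2, of Z] by (simp add: mat_monoid)
  then have Z: "Z = R\<^sup>T * (S * R)" ..
  show thesis
    by (rule that[OF WU U2, of \<theta>]) (use X Y Z in \<open>simp_all add: S_def C_def\<close>)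
qed

lemma factorization_exists:
  assumes U: "U \<in> indefinite_unitary_group n"
  obtains U1 U2 V \<theta> where "factorization n U U1 U2 V \<theta>"
proof -
  let ?S = "swap_mat n" and ?I = "signature_mat n"
  have dU: "dim_row U = n + n" "dim_col U = n + n" and UI: "(cnj_mat U)\<^sup>T * (?I * U) = ?I"
    using U by (auto simp: mem_indefinite_unitary_group_iff)
  note NU = indefinite_unitary_inverse[OF U]
  define Q where "Q = U * (?S * U\<^sup>T)"
  have dQ: "dim_row Q = n + n" "dim_col Q = n + n" using dU by (auto simp: Q_def)
  have Qsym: "Q\<^sup>T = Q" using dU by (simp add: Q_def mat_monoid)
  have SIS: "?S * (?I * ?S) = - ?I"
    by (subst (2) swap_mat_def, subst signature_mat_left, simp_all, subst swap_mat_left, simp_all)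
      (auto intro!: eq_matI simp: signature_mat_def)
  \<comment> \<open>Q is symmetric, so conj(Q) is Q^H. The inner U^H I_{n,n} U collapses to I_{n,n},
    \<open>SIS\<close> supplies the sign, and the outer product collapses because U^H also lies in
    U(n,n).\<close>
  have QIQ: "cnj_mat Q * (?I * Q) = - ?I"
  proof -
    have "cnj_mat Q * (?I * Q) = cnj_mat U * (?S * ((cnj_mat U)\<^sup>T * (?I * U) * (?S * U\<^sup>T)))"
      using dU by (simp add: Q_def mat_monoid)
    also have "\<dots> = cnj_mat U * ((?S * (?I * ?S)) * U\<^sup>T)"
      unfolding UI using dU by (simp add: mat_assoc)
    also have "\<dots> = cnj_mat U * (- (?I * U\<^sup>T))"
      unfolding SIS using dU by simp
    also have "\<dots> = - (cnj_mat U * (?I * U\<^sup>T))"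
      using dU by (intro uminus_mult_right_mat) auto
    also have "cnj_mat U * (?I * U\<^sup>T) = cnj_mat (U * (?I * (cnj_mat U)\<^sup>T))"
      using dU by (simp add: mat_monoid)
    finally show ?thesis unfolding NU(5) by simp
  qed
  obtain X Y Y' Z where "split_block Q n n = (X, Y, Y', Z)" by (metis prod_cases4)
  note blocks = split_block[OF this dQ]
  have "four_block_mat X\<^sup>T Y'\<^sup>T Y\<^sup>T Z\<^sup>T = four_block_mat X Y Y' Z"
    using Qsym unfolding blocks(5) using blocks(1-4) by (simp add: four_block_transpose)
  note sym = four_block_inject[OF this, of n]
  have X: "X\<^sup>T = X" and Y': "Y' = Y\<^sup>T"
    using sym(1,3) blocks(1-4) by auto
  have "cnj_mat Q * (?I * Q) =
      four_block_mat (cnj_mat X * X + - (cnj_mat Y * Y\<^sup>T)) (cnj_mat X * Y + - (cnj_mat Y * Z))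
        (cnj_mat Y' * X + - (cnj_mat Z * Y')) (cnj_mat Y' * Y + - (cnj_mat Z * Z))"
    unfolding blocks(5) using blocks(1-4)
    by (subst signature_mat_left, simp_all, subst four_block_cnj, simp_all,
        subst four_block_mult[of _ n]) (auto simp: Y')
  moreover have "- ?I = four_block_mat (- 1\<^sub>m n) (- 0\<^sub>m n n) (- 0\<^sub>m n n) (- (- 1\<^sub>m n))"
    unfolding signature_mat_def by (rule eq_matI) auto
  ultimately have eq: "four_block_mat (cnj_mat X * X + - (cnj_mat Y * Y\<^sup>T)) (cnj_mat X * Y + - (cnj_mat Y * Z))
        (cnj_mat Y' * X + - (cnj_mat Z * Y')) (cnj_mat Y' * Y + - (cnj_mat Z * Z)) =
      four_block_mat (- 1\<^sub>m n) (- 0\<^sub>m n n) (- 0\<^sub>m n n) (- (- 1\<^sub>m n))"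
    using QIQ by simp
  have c: "cnj_mat X * X \<in> carrier_mat n n" "cnj_mat Y * Y\<^sup>T \<in> carrier_mat n n"
    "cnj_mat X * Y \<in> carrier_mat n n" "cnj_mat Y * Z \<in> carrier_mat n n"
    "cnj_mat Y' * X + - (cnj_mat Z * Y') \<in> carrier_mat n n" "cnj_mat Y' * Y + - (cnj_mat Z * Z) \<in> carrier_mat n n"
    using blocks(1-4) by (auto intro!: carrier_matI)
  have eq1: "cnj_mat X * X + - (cnj_mat Y * Y\<^sup>T) = - 1\<^sub>m n"
    and eq2: "cnj_mat X * Y + - (cnj_mat Y * Z) = - 0\<^sub>m n n"
    using four_block_inject(1,2)[OF eq, of n] c by auto
  have YY: "cnj_mat Y * Y\<^sup>T = 1\<^sub>m n + cnj_mat X * X"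
    by (rule mat_add_uminus_solve[OF eq1]) (use c in auto)
  have "cnj_mat Y * Z = 0\<^sub>m n n + cnj_mat X * Y"
    by (rule mat_add_uminus_solve[OF eq2]) (use c in auto)
  then have YZ: "cnj_mat Y * Z = cnj_mat X * Y" using c by simp
  obtain U1 U2 \<theta> where U1: "U1 \<in> unitary_group n" and U2: "U2 \<in> unitary_group n"
    and XYZ: "X = U1 * (Sh n (\<lambda>a. 2 * \<theta> a) * U1\<^sup>T)" "Y = U1 * (Ch n (\<lambda>a. 2 * \<theta> a) * U2\<^sup>T)"
      "Z = U2 * (Sh n (\<lambda>a. 2 * \<theta> a) * U2\<^sup>T)"
    using symmetric_blocks_factorization[OF blocks(1,2,4) X YY YZ] by blast
  have U12: "U1 \<in> carrier_mat n n" "U2 \<in> carrier_mat n n"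
    using U1 U2 by (auto simp: unitary_group_def)
  define M where "M = KA_mat n U1 U2 \<theta>"
  have M: "M \<in> indefinite_unitary_group n"
    unfolding M_def by (rule KA_mat_indefinite_unitary[OF U1 U2])
  then have dM: "dim_row M = n + n" "dim_col M = n + n" and MI: "(cnj_mat M)\<^sup>T * (?I * M) = ?I"
    by (auto simp: mem_indefinite_unitary_group_iff)
  have "Y' = U2 * (Ch n (\<lambda>a. 2 * \<theta> a) * U1\<^sup>T)"
    unfolding Y' XYZ using U12 by (simp add: mat_monoid)
  \<comment> \<open>\<open>M\<close> and \<open>U\<close> yield the same Q, so they lie in the same
    coset: the quotient of \<open>U\<close> by \<open>M\<close>, called \<open>C\<close> below,
    fixes S and hence is complexified quaternionic.\<close>
  then have QM: "Q = M * (?S * M\<^sup>T)"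
    unfolding M_def KA_mat_swap[OF U12] blocks(5) XYZ[symmetric] by simp
  define N where "N = ?I * ((cnj_mat M)\<^sup>T * ?I)"
  note NM = indefinite_unitary_inverse(1-4)[OF M, folded N_def]
  define C where "C = N * U"
  have dC: "dim_row C = n + n" "dim_col C = n + n" using NM(3) dU by (auto simp: C_def)
  have MC: "M * C = U"
    unfolding C_def by (rule mat_inverse_cancel[OF NM(2)]) (use dM dU NM in auto)
  have "C * (?S * C\<^sup>T) = N * (Q * N\<^sup>T)"
    using dU NM(3,4) by (simp add: C_def Q_def mat_monoid)
  also have "\<dots> = (N * M) * (?S * (N * M)\<^sup>T)"
    unfolding QM using dM NM(3,4) by (simp add: mat_monoid)
  finally have CS: "C * (?S * C\<^sup>T) = ?S" unfolding NM(1) by simp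
  have "(cnj_mat C)\<^sup>T * (?I * C) = (cnj_mat C)\<^sup>T * ((cnj_mat M)\<^sup>T * (?I * M) * C)"
    unfolding MI by simp
  also have "\<dots> = (cnj_mat (M * C))\<^sup>T * (?I * (M * C))"
    using dM dC by (simp add: mat_monoid)
  also have "\<dots> = ?I" unfolding MC by (rule UI)
  finally have "C \<in> indefinite_unitary_group n"
    using dC by (simp add: mem_indefinite_unitary_group_iff)
  then obtain V where V: "V \<in> quat_orthogonal n" "complexify V = C"
    using complexify_surj CS by blast
  show thesis
    by (rule that[of U1 U2 V \<theta>]) (use U1 U2 V MC in \<open>simp add: factorization_def M_def KA_mat_def\<close>)
qed

section \<open>Uniqueness of the angles\<close>

lemma factorization_swap:
  assumes "factorization n U U1 U2 V \<theta>"
  shows "U * (swap_mat n * U\<^sup>T) =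
    four_block_mat (U1 * (Sh n (\<lambda>a. 2 * \<theta> a) * U1\<^sup>T)) (U1 * (Ch n (\<lambda>a. 2 * \<theta> a) * U2\<^sup>T))
      (U2 * (Ch n (\<lambda>a. 2 * \<theta> a) * U1\<^sup>T)) (U2 * (Sh n (\<lambda>a. 2 * \<theta> a) * U2\<^sup>T))"
proof -
  define M where "M = KA_mat n U1 U2 \<theta>"
  define C where "C = complexify V"
  have U12: "U1 \<in> carrier_mat n n" "U2 \<in> carrier_mat n n" and V: "V \<in> quat_orthogonal n"
    and U: "U = M * C"
    using assms by (auto simp: factorization_def unitary_group_def M_def C_def KA_mat_def)
  have Vc: "V \<in> carrier_mat n n" using V by (simp add: quat_orthogonal_def)
  have CS: "C * (swap_mat n * C\<^sup>T) = swap_mat n"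
    using V unfolding quat_orthogonal_iff[OF Vc] C_def .
  have dC: "dim_row C = n + n" "dim_col C = n + n"
    using complexify_carrier[OF Vc] by (auto simp: C_def)
  have dM: "dim_row M = n + n" "dim_col M = n + n"
    using U12 by (auto simp: M_def KA_mat_blocks)
  \<comment> \<open>The quaternionic factor enters only through C S C^T = S and disappears, so Q
    depends on U1, U2 and \<theta> alone.\<close>
  have "U * (swap_mat n * U\<^sup>T) = M * (C * (swap_mat n * C\<^sup>T) * M\<^sup>T)"
    using dC dM by (simp add: U mat_monoid)
  then show ?thesis
    unfolding CS by (simp add: M_def KA_mat_swap[OF U12])
qed

lemma proots_linear_factors:
  "proots (\<Prod>a\<leftarrow>as. [:- a, 1:]) = mset (as :: 'a :: idom list)"
proof (induction as)
  case (Cons a as)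
  have "(\<Prod>a\<leftarrow>as. [:- a, 1:]) \<noteq> 0" by (auto simp: prod_list_zero_iff)
  then have "proots ([:- a, 1:] * (\<Prod>a\<leftarrow>as. [:- a, 1:])) = proots [:- a, 1:] + mset as"
    by (subst proots_mult) (simp_all add: Cons.IH)
  then show ?case by (simp del: mult_pCons_left)
qed simp

text \<open>As \<open>W\<close> is unitary, the middle factors of X conj(X) cancel and W diag(s^2)
  W^H remains, a matrix similar to a diagonal one. The multiset of roots keeps multiplicities, which
  a permutation of the angles requires.\<close>

lemma takagi_values:
  assumes "W \<in> unitary_group n" and X: "X = W * (mat_diag n (\<lambda>a. complex_of_real (s a)) * W\<^sup>T)"
  shows "proots (char_poly (X * cnj_mat X)) = mset (map (\<lambda>a. complex_of_real ((s a)\<^sup>2)) [0..<n])"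
proof -
  note W = unitary_groupD[OF assms(1)] and can = unitary_cancel[OF assms(1)]
  let ?D = "mat_diag n (\<lambda>a. complex_of_real ((s a)\<^sup>2))"
  have "X * cnj_mat X = W * (?D * (cnj_mat W)\<^sup>T)"
    using W(1,2) by (simp add: X mat_monoid can power2_eq_square)
  then have "similar_mat_wit (X * cnj_mat X) ?D W (cnj_mat W)\<^sup>T"
    using W by (intro similar_mat_witI[of _ _ n]) (auto simp: mat_assoc)
  then have "char_poly (X * cnj_mat X) = char_poly ?D"
    by (intro char_poly_similar) (auto simp: similar_mat_def)
  also have "\<dots> = (\<Prod>a\<leftarrow>diag_mat ?D. [:- a, 1:])"
    by (rule char_poly_upper_triangular[of _ n]) (auto simp: upper_triangular_def mat_diag_def)
  also have "diag_mat ?D = map (\<lambda>a. complex_of_real ((s a)\<^sup>2)) [0..<n]"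
    by (auto simp: diag_mat_def mat_diag_def)
  finally show ?thesis by (simp only: proots_linear_factors)
qed

lemma factorization_unique:
  assumes 1: "factorization n U U1 U2 V \<theta>" and 2: "factorization n U U1' U2' V' \<theta>'"
  shows "equal_up_to_order_and_signs n \<theta> \<theta>'"
proof -
  have U: "U1 \<in> unitary_group n" "U2 \<in> unitary_group n" "U1' \<in> unitary_group n" "U2' \<in> unitary_group n"
    using assms by (auto simp: factorization_def)
  note d = U[THEN unitary_groupD(1)] U[THEN unitary_groupD(2)]
  \<comment> \<open>Both sides are the upper left block of the same matrix U S U^T, computed from
    either factorization.\<close>
  have X: "U1 * (Sh n (\<lambda>a. 2 * \<theta> a) * U1\<^sup>T) = U1' * (Sh n (\<lambda>a. 2 * \<theta>' a) * U1'\<^sup>T)"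
    by (rule four_block_inject(1)[OF factorization_swap[OF 1, unfolded factorization_swap[OF 2], symmetric], of n])
      (auto intro!: carrier_matI simp: d)
  let ?xs = "\<lambda>\<theta>. map (\<lambda>a. complex_of_real ((sinh (2 * \<theta> a))\<^sup>2)) [0..<n]"
  have "mset (?xs \<theta>') = mset (?xs \<theta>)"
    using takagi_values[OF U(1) refl, of "\<lambda>a. sinh (2 * \<theta> a)"]
      takagi_values[OF U(3) refl, of "\<lambda>a. sinh (2 * \<theta>' a)"] X
    by (simp add: Sh_def)
  then obtain p where p: "p permutes {..<length (?xs \<theta>)}" "permute_list p (?xs \<theta>) = ?xs \<theta>'"
    by (rule mset_eq_permutation)
  have "p permutes {..<n}" using p(1) by simp
  moreover have "\<theta>' a = \<theta> (p a) \<or> \<theta>' a = - \<theta> (p a)" if a: "a < n" for a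
  proof -
    have pa: "p a < n" using permutes_in_image[OF \<open>p permutes {..<n}\<close>, of a] a by simp
    have "?xs \<theta>' ! a = ?xs \<theta> ! p a"
      using p a by (metis (no_types, lifting) permute_list_nth length_map length_upt minus_nat.diff_0)
    then have "(sinh (2 * \<theta>' a))\<^sup>2 = (sinh (2 * \<theta> (p a)))\<^sup>2"
      using a pa by (simp flip: of_real_power)
    \<comment> \<open>Since sinh is odd, the sign left open by the square moves into the argument,
      where injectivity of sinh applies.\<close>
    then have "sinh (2 * \<theta>' a) = sinh (2 * \<theta> (p a)) \<or> sinh (2 * \<theta>' a) = sinh (2 * (- \<theta> (p a)))"
      by (simp add: power2_eq_iff)
    then show ?thesis unfolding sinh_real_eq_iff by auto
  qed
  ultimately show ?thesis by (auto simp: equal_up_to_order_and_signs_def)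
qed

theorem theorem7p9:
  fixes n :: nat and U :: "complex mat"
  assumes "U \<in> indefinite_unitary_group n"
  shows "\<exists>U1 U2 V \<theta>.
           factorization n U U1 U2 V \<theta> \<and>
           (\<forall>U1' U2' V' \<theta>'. factorization n U U1' U2' V' \<theta>' \<longrightarrow>
              equal_up_to_order_and_signs n \<theta> \<theta>')"
  using factorization_exists[OF assms] factorization_unique by metis

end
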